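(* Let $G$ be a graph and let $\alpha\in H_1(G,\mathbb{Z})$ be nonzero. Then $\mathcal{C}_G(\alpha,\Vert\alpha\Vert)$ is nonempty if and only if $\alpha$ is connected.
   Context: A graph is finite, may have loops and multiple edges, and has no isolated vertices. Each edge $e$ gives two oriented edges $\mathbf{e}$ and $\mathbf{e}^{-1}$; $\mathbf{E}(G)$ is the set of oriented edges, $\mathbf{e}(0),\mathbf{e}(1)$ initial/terminal vertices. An orientation $\mathfrak{o}$ chooses one oriented edge per edge, giving $\mathbf{E}_{\mathfrak{o}}(G)$. A walk of length $l$ is a sequence $\mathbf{a}_1\cdots\mathbf{a}_l$ with $\mathbf{a}_{i+1}(0)=\mathbf{a}_i(1)$; a circuit is a closed walk ($\mathbf{a}_l(1)=\mathbf{a}_1(0)$) with no backtrack ($\mathbf{a}_{i+1}\neq\mathbf{a}_i^{-1}$) and no tail ($\mathbf{a}_1\neq\mathbf{a}_l^{-1}$). $C_1(G,\mathbb{Z})$ is the free abelian group on $\mathbf{E}_{\mathfrak{o}}(G)$, with $\mathbf{e}^{-1}=-\mathbf{e}$. For $\alpha=\sum_{\mathbf{e}\in\mathbf{E}_{\mathfrak{o}}(G)}c_{\mathbf{e}}\mathbf{e}$: $\deg_\alpha(\mathbf{e})=c_{\mathbf{e}}$, $\deg_\alpha(\mathbf{e}^{-1})=-c_{\mathbf{e}}$, $\deg_\alpha(v)=\sum_{\mathbf{e}\in\mathbf{E}(G),\mathbf{e}(0)=v}\deg_\alpha(\mathbf{e})$; $H_1(G,\mathbb{Z})=\{\alpha:\deg_\alpha(v)=0\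 \forall v\}$. The abelianization of a walk is the sum of its oriented edges in $C_1(G,\mathbb{Z})$. $\Vert\alpha\Vert=\sum_{\mathbf{e}\in\mathbf{E}_{\mathfrak{o}}(G)}|c_{\mathbf{e}}|$. $\mathcal{C}_G(\alpha,l)$ is the set of circuits of length $l$ with abelianization $\alpha$. A nonzero $\alpha$ is uniquely $\sum c_{\mathbf{e}}\mathbf{e}$ with all $c_{\mathbf{e}}>0$ over oriented edges with distinct underlying edges; $\mathrm{supp}(\alpha)$ is the subgraph formed by these underlying edges and their endpoints; $\alpha$ is connected if $\mathrm{supp}(\alpha)$ is connected. *)

theory Defs
  imports "Graph_Theory.Graph_Theory" "HOL-Algebra.Free_Abelian_Groups"
begin

text \<open>
  Serre's encoding of a finite graph with loops and multiple edges: the arcs of \<open>G\<close> are the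
  \<^emph>\<open>oriented\<close> edges and \<open>arev\<close> maps each of them to its inverse, so that an unoriented
  edge is a pair \<open>{a, arev a}\<close>. By \<^locale>\<open>bidirected_digraph\<close>, \<open>arev a \<noteq> a\<close> for every arc,
  loops included; outside the arcs \<open>arev\<close> is the identity.
\<close>

locale finite_multigraph = fin_digraph G + bidirected_digraph G arev
  for G :: "('v, 'e) pre_digraph" and arev :: "'e \<Rightarrow> 'e" +
  assumes no_isolated: "v \<in> verts G \<Longrightarrow> \<exists>a \<in> arcs G. tail G a = v"

definition orientation :: "('v, 'e) pre_digraph \<Rightarrow> ('e \<Rightarrow> 'e) \<Rightarrow> 'e set \<Rightarrow> bool" where
  "orientation G arev Eo \<longleftrightarrow> Eo \<subseteq> arcs G \<and> (\<forall>a \<in> arcs G. (a \<in> Eo) \<noteq> (arev a \<in> Eo))"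

definition circuit :: "('v, 'e) pre_digraph \<Rightarrow> ('e \<Rightarrow> 'e) \<Rightarrow> 'e list \<Rightarrow> bool" where
  "circuit G arev p \<longleftrightarrow>
     wf_digraph.closed_w G p \<and>
     (\<forall>i. Suc i < length p \<longrightarrow> p ! Suc i \<noteq> arev (p ! i)) \<and>
     hd p \<noteq> arev (last p)"

text \<open>
  The chain group \<open>C\<^sub>1(G, \<int>)\<close> relative to an orientation \<open>Eo\<close> is the library's
  \<open>free_Abelian_group Eo\<close>: finitely supported functions \<open>'e \<Rightarrow>\<^sub>0 int\<close> that vanish outside \<open>Eo\<close>.
  The next function realises every oriented edge in it, with \<open>arev a = - a\<close>.
\<close>

definition arc_chain :: "('e \<Rightarrow> 'e) \<Rightarrow> 'e set \<Rightarrow> 'e \<Rightarrow> 'e \<Rightarrow>\<^sub>0 int" where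
  "arc_chain arev Eo a = (if a \<in> Eo then frag_of a else - frag_of (arev a))"

definition arc_deg :: "('e \<Rightarrow> 'e) \<Rightarrow> 'e set \<Rightarrow> ('e \<Rightarrow>\<^sub>0 int) \<Rightarrow> 'e \<Rightarrow> int" where
  "arc_deg arev Eo \<alpha> a =
     (if a \<in> Eo then Poly_Mapping.lookup \<alpha> a else - Poly_Mapping.lookup \<alpha> (arev a))"

text \<open>The sum runs over both orientations of every edge, so a loop at \<open>v\<close> contributes \<open>0\<close>.\<close>

definition vert_deg ::
  "('v, 'e) pre_digraph \<Rightarrow> ('e \<Rightarrow> 'e) \<Rightarrow> 'e set \<Rightarrow> ('e \<Rightarrow>\<^sub>0 int) \<Rightarrow> 'v \<Rightarrow> int" where
  "vert_deg G arev Eo \<alpha> v = (\<Sum>a \<in> out_arcs G v. arc_deg arev Eo \<alpha> a)"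

definition H1 :: "('v, 'e) pre_digraph \<Rightarrow> ('e \<Rightarrow> 'e) \<Rightarrow> 'e set \<Rightarrow> ('e \<Rightarrow>\<^sub>0 int) set" where
  "H1 G arev Eo =
     {\<alpha> \<in> carrier (free_Abelian_group Eo). \<forall>v \<in> verts G. vert_deg G arev Eo \<alpha> v = 0}"

definition chain_norm :: "'e set \<Rightarrow> ('e \<Rightarrow>\<^sub>0 int) \<Rightarrow> nat" where
  "chain_norm Eo \<alpha> = (\<Sum>a \<in> Eo. nat \<bar>Poly_Mapping.lookup \<alpha> a\<bar>)"

definition abelianization :: "('e \<Rightarrow> 'e) \<Rightarrow> 'e set \<Rightarrow> 'e list \<Rightarrow> 'e \<Rightarrow>\<^sub>0 int" where
  "abelianization arev Eo p = (\<Sum>a \<leftarrow> p. arc_chain arev Eo a)"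

definition circuits ::
  "('v, 'e) pre_digraph \<Rightarrow> ('e \<Rightarrow> 'e) \<Rightarrow> 'e set \<Rightarrow> ('e \<Rightarrow>\<^sub>0 int) \<Rightarrow> nat \<Rightarrow> 'e list set" where
  "circuits G arev Eo \<alpha> l =
     {p. circuit G arev p \<and> length p = l \<and> abelianization arev Eo p = \<alpha>}"

text \<open>
  The unique expansion of \<open>\<alpha>\<close> with positive coefficients over oriented edges with distinct
  underlying edges is \<open>\<Sum>a \<in> positive_arcs G arev Eo \<alpha>. arc_deg arev Eo \<alpha> a \<cdot> a\<close>.
\<close>

definition positive_arcs ::
  "('v, 'e) pre_digraph \<Rightarrow> ('e \<Rightarrow> 'e) \<Rightarrow> 'e set \<Rightarrow> ('e \<Rightarrow>\<^sub>0 int) \<Rightarrow> 'e set" where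
  "positive_arcs G arev Eo \<alpha> = {a \<in> arcs G. arc_deg arev Eo \<alpha> a > 0}"

text \<open>The support, as a subgraph of \<open>G\<close>, contains both orientations of each of its edges.\<close>

definition chain_supp ::
  "('v, 'e) pre_digraph \<Rightarrow> ('e \<Rightarrow> 'e) \<Rightarrow> 'e set \<Rightarrow> ('e \<Rightarrow>\<^sub>0 int) \<Rightarrow> ('v, 'e) pre_digraph" where
  "chain_supp G arev Eo \<alpha> =
     (let P = positive_arcs G arev Eo \<alpha> in
      \<lparr> verts = tail G ` P \<union> head G ` P, arcs = P \<union> arev ` P, tail = tail G, head = head G \<rparr>)"

definition connected_chain ::
  "('v, 'e) pre_digraph \<Rightarrow> ('e \<Rightarrow> 'e) \<Rightarrow> 'e set \<Rightarrow> ('e \<Rightarrow>\<^sub>0 int) \<Rightarrow> bool" where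
  "connected_chain G arev Eo \<alpha> \<longleftrightarrow> Digraph_Component.connected (chain_supp G arev Eo \<alpha>)"

end

theory Submission
  imports Defs
begin

text \<open>
  Replace every oriented edge by as many parallel copies as its coefficient in the positive expansion
  of \<open>\<alpha>\<close>. Vanishing of the boundary says that in- and out-degrees agree, so if the support is connected,
  an Euler circuit of the blown-up graph projects to a circuit of length \<open>\<parallel>\<alpha>\<parallel>\<close>. Conversely, a walk
  whose length equals the norm of its abelianization admits no cancellation; it runs precisely
  through the positive oriented edges and thereby connects the support.
\<close>

text \<open>Only ends of arcs of positive weight become vertices: any other vertex of
  \<open>G\<close> would be isolated and spoil the connectedness that an Euler circuit needs. The
  second component of an arc numbers its copies.\<close>

definition blow_up :: "('v, 'e) pre_digraph \<Rightarrow> ('e \<Rightarrow> nat) \<Rightarrow> ('v, 'e \<times> nat) pre_digraph" where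
  "blow_up G w =
     \<lparr> verts = tail G ` {a \<in> arcs G. w a > 0} \<union> head G ` {a \<in> arcs G. w a > 0},
       arcs = (SIGMA a:arcs G. {..<w a}), tail = tail G \<circ> fst, head = head G \<circ> fst \<rparr>"

text \<open>An Euler trail uses every copy once; forgetting the copy numbers turns this into a
  prescribed multiplicity.\<close>

lemma count_list_map_fst:
  assumes "distinct xs" "set xs = Sigma A B" "a \<in> A"
  shows "count_list (map fst xs) a = card (B a)"
proof -
  have "count_list (map fst xs) a = length (filter (\<lambda>x. fst x = a) xs)"
    by (induction xs) auto
  also have "\<dots> = card {x \<in> set xs. fst x = a}"
    using assms(1) by (metis distinct_card distinct_filter set_filter)
  also have "{x \<in> set xs. fst x = a} = Pair a ` B a"
    using assms(2,3) by auto
  finally show ?thesis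
    by (simp add: card_image inj_on_def)
qed

section \<open>Degrees and walks in the blown-up graph\<close>

lemma (in fin_digraph) fin_digraph_blow_up: "fin_digraph (blow_up G w)"
proof
  show "finite (verts (blow_up G w))" "finite (arcs (blow_up G w))"
    by (simp_all add: blow_up_def)
qed (auto simp: blow_up_def)

lemma (in fin_digraph) out_degree_blow_up:
  "out_degree (blow_up G w) v = (\<Sum>a \<in> out_arcs G v. w a)"
proof -
  have "out_arcs (blow_up G w) v = (SIGMA a:out_arcs G v. {..<w a})"
    by (auto simp: out_arcs_def blow_up_def)
  moreover have "card (SIGMA a:out_arcs G v. {..<w a}) = (\<Sum>a \<in> out_arcs G v. card {..<w a})"
    by (rule card_SigmaI) auto
  ultimately show ?thesis
    by (simp add: out_degree_def)
qed

lemma (in fin_digraph) in_degree_blow_up: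
  "in_degree (blow_up G w) v = (\<Sum>a \<in> in_arcs G v. w a)"
proof -
  have "in_arcs (blow_up G w) v = (SIGMA a:in_arcs G v. {..<w a})"
    by (auto simp: in_arcs_def blow_up_def)
  moreover have "card (SIGMA a:in_arcs G v. {..<w a}) = (\<Sum>a \<in> in_arcs G v. card {..<w a})"
    by (rule card_SigmaI) auto
  ultimately show ?thesis
    by (simp add: in_degree_def)
qed

text \<open>Chaining depends only on tails and heads, which copies inherit. This projects a trail of
  the blow-up to \<open>G\<close>, although the vertex sets may differ.\<close>

lemma cas_blow_up:
  "pre_digraph.cas (blow_up G w) u p v \<longleftrightarrow> pre_digraph.cas G u (map fst p) v"
proof (induction p arbitrary: u)
  case Nil
  show ?case
    by (simp add: pre_digraph.cas.simps(1))
next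
  case (Cons x p)
  have "tail (blow_up G w) x = tail G (fst x)" "head (blow_up G w) x = head G (fst x)"
    by (simp_all add: blow_up_def)
  then show ?case
    by (simp add: Cons.IH pre_digraph.cas.simps(2))
qed

section \<open>Coefficients of chains, and walks of minimal length\<close>

locale oriented_multigraph = finite_multigraph G arev
  for G :: "('v, 'e) pre_digraph" and arev :: "'e \<Rightarrow> 'e" +
  fixes Eo :: "'e set"
  assumes orientation: "orientation G arev Eo"
begin

lemma Eo_subset: "Eo \<subseteq> arcs G"
  using orientation by (simp add: orientation_def)

lemma arev_mem_Eo: "a \<in> arcs G \<Longrightarrow> arev a \<in> Eo \<longleftrightarrow> a \<notin> Eo"
  using orientation unfolding orientation_def by blast

lemma arev_mem_arcs: "arev a \<in> arcs G \<longleftrightarrow> a \<in> arcs G"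
  using arev_dom[of a] arev_dom[of "arev a"] by auto

lemma finite_Eo: "finite Eo"
  using Eo_subset finite_arcs by (rule finite_subset)

lemma arcs_eq_Eo: "arcs G = Eo \<union> arev ` Eo"
proof -
  have "a \<in> arev ` Eo" if "a \<in> arcs G" "a \<notin> Eo" for a
    using arev_mem_Eo[of a] that by (intro image_eqI[of _ _ "arev a"]) auto
  then show ?thesis
    using Eo_subset arev_mem_arcs by auto
qed

lemma sum_arcs:
  fixes f :: "'e \<Rightarrow> 'b::comm_monoid_add"
  shows "(\<Sum>a \<in> arcs G. f a) = (\<Sum>a \<in> Eo. f a + f (arev a))"
proof -
  have "Eo \<inter> arev ` Eo = {}"
    using Eo_subset arev_mem_Eo by auto
  then show ?thesis
    by (simp add: arcs_eq_Eo sum.union_disjoint finite_Eo sum.reindex inj_on_arev sum.distrib)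
qed

lemma arc_deg_arev:
  assumes "a \<in> arcs G"
  shows "arc_deg arev Eo \<alpha> (arev a) = - arc_deg arev Eo \<alpha> a"
  using arev_mem_Eo[OF assms] by (auto simp: arc_deg_def)

text \<open>Of two inverse arcs at most one has positive degree, so \<open>nat\<close> keeps each
  absolute value exactly once. In this form the norm can be compared with the arc counts of a
  walk.\<close>

lemma chain_norm_eq_sum_arcs:
  "chain_norm Eo \<alpha> = (\<Sum>a \<in> arcs G. nat (arc_deg arev Eo \<alpha> a))"
  unfolding chain_norm_def sum_arcs
proof (intro sum.cong refl)
  fix a assume "a \<in> Eo"
  then show "nat \<bar>Poly_Mapping.lookup \<alpha> a\<bar> =
      nat (arc_deg arev Eo \<alpha> a) + nat (arc_deg arev Eo \<alpha> (arev a))"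
    using Eo_subset arc_deg_arev[of a \<alpha>] by (auto simp: arc_deg_def)
qed

lemma arc_deg_abelianization:
  assumes "set p \<subseteq> arcs G" "a \<in> arcs G"
  shows "arc_deg arev Eo (abelianization arev Eo p) a
           = int (count_list p a) - int (count_list p (arev a))"
  using assms(1)
proof (induction p)
  case Nil
  then show ?case by (simp add: abelianization_def arc_deg_def)
next
  case (Cons b p)
  have "arc_deg arev Eo (abelianization arev Eo (b # p)) a =
      arc_deg arev Eo (arc_chain arev Eo b) a + arc_deg arev Eo (abelianization arev Eo p) a"
    by (simp add: abelianization_def arc_deg_def lookup_add)
  moreover have "arc_deg arev Eo (arc_chain arev Eo b) a = of_bool (b = a) - of_bool (b = arev a)"
  proof -
    have "arev b = a \<longleftrightarrow> b = arev a" "arev b = arev a \<longleftrightarrow> b = a"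
      by (metis arev_arev)+
    \<comment> \<open>\<open>arev\<close> fixes no arc, not even a loop, so the two indicators never
      overlap.\<close>
    moreover have "b = a \<Longrightarrow> b \<noteq> arev a"
      using assms(2) arev_dom by auto
    ultimately show ?thesis
      using arev_mem_Eo[OF assms(2)] arev_mem_Eo[of b] Cons.prems
      by (cases "a \<in> Eo"; cases "b \<in> Eo")
        (auto simp: arc_deg_def arc_chain_def lookup_single when_def)
  qed
  ultimately show ?case
    using Cons by simp
qed

lemma abelianization_in_carrier:
  assumes "set p \<subseteq> arcs G"
  shows "abelianization arev Eo p \<in> carrier (free_Abelian_group Eo)"
  using assms
proof (induction p)
  case Nil
  then show ?case by (simp add: abelianization_def)
next
  case (Cons b p)
  have "Poly_Mapping.keys (arc_chain arev Eo b) \<subseteq> Eo"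
    using Cons.prems arev_mem_Eo[of b] by (simp add: arc_chain_def)
  then show ?case
    using Cons keys_add[of "arc_chain arev Eo b" "abelianization arev Eo p"]
    by (auto simp: abelianization_def)
qed

text \<open>Arc degrees see only the coefficients on \<open>Eo\<close>; membership in the carrier
  makes all others vanish.\<close>

lemma chain_eqI:
  assumes "\<alpha> \<in> carrier (free_Abelian_group Eo)" "\<beta> \<in> carrier (free_Abelian_group Eo)"
    and "\<And>a. a \<in> arcs G \<Longrightarrow> arc_deg arev Eo \<alpha> a = arc_deg arev Eo \<beta> a"
  shows "\<alpha> = \<beta>"
proof (rule poly_mapping_eqI)
  fix a
  show "Poly_Mapping.lookup \<alpha> a = Poly_Mapping.lookup \<beta> a"
  proof (cases "a \<in> Eo")
    case True
    then show ?thesis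
      using assms(3)[of a] Eo_subset by (auto simp: arc_deg_def)
  next
    case False
    then have "a \<notin> Poly_Mapping.keys \<alpha>" "a \<notin> Poly_Mapping.keys \<beta>"
      using assms(1,2) by auto
    then show ?thesis
      by (simp add: in_keys_iff)
  qed
qed

text \<open>
  The count of \<open>a\<close> minus that of \<open>arev a\<close> is the coefficient, so the counts dominate the positive
  parts of the coefficients; equality of the totals forces equality throughout.
\<close>

lemma minimal_walk_iff:
  assumes p: "set p \<subseteq> arcs G" and \<alpha>: "\<alpha> \<in> carrier (free_Abelian_group Eo)"
  shows "length p = chain_norm Eo \<alpha> \<and> abelianization arev Eo p = \<alpha> \<longleftrightarrow>
           (\<forall>a \<in> arcs G. count_list p a = nat (arc_deg arev Eo \<alpha> a))"
    (is "?L \<longleftrightarrow> ?R")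
proof
  assume L: ?L
  have le: "nat (arc_deg arev Eo \<alpha> a) \<le> count_list p a" if "a \<in> arcs G" for a
    using arc_deg_abelianization[OF p that] L by simp
  have eq: "(\<Sum>a \<in> arcs G. nat (arc_deg arev Eo \<alpha> a)) = (\<Sum>a \<in> arcs G. count_list p a)"
    using L by (simp add: sum_count_set[OF p] flip: chain_norm_eq_sum_arcs)
  show ?R
    using sum_mono_inv[OF eq le _ finite_arcs] by simp
next
  assume R: ?R
  then have "length p = chain_norm Eo \<alpha>"
    by (simp add: chain_norm_eq_sum_arcs flip: sum_count_set[OF p])
  moreover have "abelianization arev Eo p = \<alpha>"
  proof (rule chain_eqI[OF abelianization_in_carrier[OF p] \<alpha>])
    fix a assume a: "a \<in> arcs G"
    \<comment> \<open>The difference of counts recovers the coefficient, since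
      \<open>nat d - nat (- d) = d\<close> over the integers.\<close>
    then show "arc_deg arev Eo (abelianization arev Eo p) a = arc_deg arev Eo \<alpha> a"
      using R by (simp add: arc_deg_abelianization[OF p a] arev_mem_arcs arc_deg_arev)
  qed
  ultimately show ?L ..
qed

lemma set_eq_positive_arcs:
  assumes "set p \<subseteq> arcs G" "\<forall>a \<in> arcs G. count_list p a = nat (arc_deg arev Eo \<alpha> a)"
  shows "set p = positive_arcs G arev Eo \<alpha>"
proof -
  have "a \<in> set p \<longleftrightarrow> 0 < arc_deg arev Eo \<alpha> a" if "a \<in> arcs G" for a
    using assms(2) that count_list_0_iff[of p a] by force
  then show ?thesis
    using assms(1) by (auto simp: positive_arcs_def)
qed

section \<open>Euler circuits of the blow-up and minimal circuits of \<open>G\<close>\<close>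

lemma connected_blow_up_iff:
  "Digraph_Component.connected (blow_up G (\<lambda>a. nat (arc_deg arev Eo \<alpha> a)))
     \<longleftrightarrow> connected_chain G arev Eo \<alpha>"
proof -
  let ?M = "blow_up G (\<lambda>a. nat (arc_deg arev Eo \<alpha> a))"
  let ?P = "positive_arcs G arev Eo \<alpha>"
  let ?ends = "\<lambda>a. {(tail G a, head G a), (head G a, tail G a)}"
  have "fst ` arcs ?M = ?P"
    by (simp add: blow_up_def positive_arcs_def fst_image_Sigma lessThan_empty_iff not_le)
  moreover have "mk_symmetric ?M =
      \<lparr>pverts = tail G ` ?P \<union> head G ` ?P, parcs = \<Union> (?ends ` fst ` arcs ?M)\<rparr>"
    by (simp add: mk_symmetric_def blow_up_def positive_arcs_def image_image)
  \<comment> \<open>Reversing an arc swaps the two pairs it contributes, so adding inverses changes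
    nothing; copies were already merged by \<open>fst\<close>. Hence both graphs have the same
    symmetric closure, which alone decides connectedness.\<close>
  moreover have "\<Union> (?ends ` (?P \<union> arev ` ?P)) = \<Union> (?ends ` ?P)"
    by (auto simp: positive_arcs_def)
  ultimately have "mk_symmetric ?M = mk_symmetric (chain_supp G arev Eo \<alpha>)"
    by (simp add: mk_symmetric_def chain_supp_def Let_def)
  then show ?thesis
    by (simp add: connected_chain_def Digraph_Component.connected_def)
qed

text \<open>Arcs into \<open>v\<close> are the inverses of those out of \<open>v\<close>. So over
  the outgoing arcs, the out-degree sums the positive parts of the coefficients and the in-degree
  the negative parts; their difference is \<open>vert_deg\<close>.\<close>

lemma balanced_blow_up:
  assumes "\<alpha> \<in> H1 G arev Eo" "v \<in> verts G"
  shows "in_degree (blow_up G (\<lambda>a. nat (arc_deg arev Eo \<alpha> a))) v =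
         out_degree (blow_up G (\<lambda>a. nat (arc_deg arev Eo \<alpha> a))) v"
proof -
  let ?d = "arc_deg arev Eo \<alpha>"
  have "int (\<Sum>a \<in> in_arcs G v. nat (?d a)) = (\<Sum>a \<in> out_arcs G v. int (nat (- ?d a)))"
    by (simp add: in_arcs_eq sum.reindex inj_on_arev arc_deg_arev)
  moreover have "(\<Sum>a \<in> out_arcs G v. int (nat (?d a)) - int (nat (- ?d a))) = vert_deg G arev Eo \<alpha> v"
    unfolding vert_deg_def by (intro sum.cong) auto
  moreover have "vert_deg G arev Eo \<alpha> v = 0"
    using assms by (simp add: H1_def)
  ultimately show ?thesis
    unfolding in_degree_blow_up out_degree_blow_up
    by (simp add: sum_subtractf flip: of_nat_eq_iff[where 'a = int])
qed

lemma circuit_if_connected: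
  assumes H1: "\<alpha> \<in> H1 G arev Eo" and "\<alpha> \<noteq> 0" and con: "connected_chain G arev Eo \<alpha>"
  shows "circuits G arev Eo \<alpha> (chain_norm Eo \<alpha>) \<noteq> {}"
proof -
  let ?d = "arc_deg arev Eo \<alpha>"
  let ?M = "blow_up G (\<lambda>a. nat (?d a))"
  interpret M: fin_digraph ?M
    by (rule fin_digraph_blow_up)
  have verts_M: "verts ?M \<subseteq> verts G"
    by (auto simp: blow_up_def)
  obtain u q where q: "M.euler_trail u q u"
    using M.closed_euler1 con balanced_blow_up[OF H1] verts_M
    by (auto simp: connected_blow_up_iff)
  define p where "p = map fst q"
  have "M.cas u q u" "u \<in> verts ?M" "set q = arcs ?M" and "distinct q"
    using q by (auto simp only: M.euler_trail_def M.trail_def M.awalk_def)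
  then have set_q: "set q = (SIGMA a:arcs G. {..<nat (?d a)})"
    and u: "u \<in> verts G" and cas: "cas u p u"
    using verts_M by (simp_all add: cas_blow_up p_def) (auto simp: blow_up_def)
  then have p: "set p \<subseteq> arcs G" and count: "\<forall>a \<in> arcs G. count_list p a = nat (?d a)"
    using count_list_map_fst[OF \<open>distinct q\<close> set_q] by (auto simp: p_def set_q)
  have \<alpha>: "\<alpha> \<in> carrier (free_Abelian_group Eo)"
    using H1 by (simp add: H1_def)
  have min: "length p = chain_norm Eo \<alpha>" "abelianization arev Eo p = \<alpha>"
    using minimal_walk_iff[OF p \<alpha>] count by auto
  \<comment> \<open>A closed walk must be nonempty; this is where \<alpha> \<noteq> 0
    enters.\<close>
  have "p \<noteq> []"
    using min(2) \<open>\<alpha> \<noteq> 0\<close> by (auto simp: abelianization_def)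
  \<comment> \<open>The inverse of a positive arc has negative degree, so it cannot occur in
    \<open>p\<close>. This excludes backtracks and a tail at once, also when \<open>p\<close> is a
    single loop.\<close>
  moreover have no_inverse: "b \<noteq> arev a" if "a \<in> set p" "b \<in> set p" for a b
    using that arc_deg_arev[of a \<alpha>] set_eq_positive_arcs[OF p count]
    by (auto simp: positive_arcs_def)
  ultimately have "circuit G arev p"
    using u p cas by (auto simp: circuit_def closed_w_def awalk_def)
  then show ?thesis
    using min by (auto simp: circuits_def)
qed

lemma connected_if_circuit:
  assumes H1: "\<alpha> \<in> H1 G arev Eo" and "circuits G arev Eo \<alpha> (chain_norm Eo \<alpha>) \<noteq> {}"
  shows "connected_chain G arev Eo \<alpha>"
proof -
  let ?P = "positive_arcs G arev Eo \<alpha>" and ?S = "chain_supp G arev Eo \<alpha>"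
  obtain p u where p: "awalk u p u" "p \<noteq> []"
    and min: "length p = chain_norm Eo \<alpha>" "abelianization arev Eo p = \<alpha>"
    using assms(2) by (auto simp: circuits_def circuit_def closed_w_def)
  have "\<alpha> \<in> carrier (free_Abelian_group Eo)"
    using H1 by (simp add: H1_def)
  then have set_p: "set p = ?P"
    using min p(1) minimal_walk_iff[of p \<alpha>] set_eq_positive_arcs[of p \<alpha>] by auto
  interpret S: wf_digraph ?S
    by unfold_locales
      (auto simp: chain_supp_def Let_def positive_arcs_def arev_mem_arcs)
  have compat: "compatible G ?S"
    by (simp add: compatible_def chain_supp_def Let_def)
  have verts_p: "set (awalk_verts u p) = verts ?S"
    using set_awalk_verts_not_Nil[OF p] set_p by (simp add: chain_supp_def Let_def)
  \<comment> \<open>The walk uses only arcs of its support, so it can be read as a walk inside that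
    subgraph.\<close>
  have "S.awalk u p u"
    using p(1) hd_in_awalk_verts(1)[OF p(1)] set_p verts_p unfolding S.awalk_def
    by (auto simp: compatible_cas[OF compat] chain_supp_def Let_def)
  \<comment> \<open>All vertices of the support lie on this one walk, whose segments join any two of
    them up to direction.\<close>
  then have "w1 \<rightarrow>\<^sup>*\<^bsub>mk_symmetric ?S\<^esub> w2" if "w1 \<in> verts ?S" "w2 \<in> verts ?S" for w1 w2
    using that S.sym_reachableI_in_awalk verts_p by (simp add: compatible_awalk_verts[OF compat])
  \<comment> \<open>\<open>connected\<close> excludes the empty graph; the vertex list of a walk is
    never empty.\<close>
  moreover have "verts ?S \<noteq> {}"
    using verts_p by force
  ultimately show ?thesis
    by (auto simp: connected_chain_def Digraph_Component.connected_def)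
qed

end

theorem theorem3p3:
  fixes G :: "('v, 'e) pre_digraph" and arev :: "'e \<Rightarrow> 'e" and Eo :: "'e set"
    and \<alpha> :: "'e \<Rightarrow>\<^sub>0 int"
  assumes "finite_multigraph G arev"
    and "orientation G arev Eo"
    and "\<alpha> \<in> H1 G arev Eo"
    and "\<alpha> \<noteq> 0"
  shows "circuits G arev Eo \<alpha> (chain_norm Eo \<alpha>) \<noteq> {} \<longleftrightarrow> connected_chain G arev Eo \<alpha>"
proof -
  interpret oriented_multigraph G arev Eo
    using assms(1,2) by (simp add: oriented_multigraph_def oriented_multigraph_axioms_def)
  show ?thesis
    using circuit_if_connected connected_if_circuit assms(3,4) by blast
qed

end
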